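(* Let $U\subset\mathbb R^2_{x,y}$ be a planar billiard table (closed domain with smooth boundary) and let $Z=U\times\mathbb R\subset\mathbb R^3$, where $\mathbb R^3$ carries the standard contact structure $\xi_{\mathrm{std}}$ and the sub-Riemannian metric $g_{\mathrm{std}}$. Then the billiard trajectories $\gamma$ in $Z$ are lifts of magnetic billiard trajectories $\pi\circ\gamma$ in $U$. The momentum $a$ of $\gamma$ coincides with the magnetic curvature of $\pi\circ\gamma$.
   Context: On $\mathbb R^3$ let $\alpha=dz-\tfrac12(x\,dy-y\,dx)=dz-\tfrac12r^2d\theta$, $\xi_{\mathrm{std}}=\ker\alpha$, and $g_{\mathrm{std}}=dx^2+dy^2$ restricted to $\xi_{\mathrm{std}}$. Write covectors as $\lambda=a\alpha+b\,dx+c\,dy$; the dual norm is $H(\lambda)=\sqrt{b^2+c^2}$ and $S=\{b^2+c^2=1\}$. Geodesics parametrised by arclength are the projections to $\mathbb R^3$ of Hamiltonian orbits of $H$ in $S$; the coordinate $a$ is constant along such an orbit and is called the (magnetic) momentum. $\pi(x,y,z)=(x,y)$ is the Lagrangian projection; a planar curve lifts, uniquely up to the choice of initial $z$, to a curve tangent to $\xi_{\mathrm{std}}$. A billiard trajectory in a table $W\subset\mathbb R^3$ is a curve in $W$, parametrised by arclength, consisting of geodesic segments between reflection points on $\partial W$, such that at each reflection point $q$ the ingoing and outgoing momenta $\lambda_{\rm in}\ne\lambda_{\rm out}\in S\cap T_q^*\mathbb R^3$ satisfy $\lambda_{\rm in}-\lambda_{\rm out}\in\mathrm{Ann}(T_q\partial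 W)$. A magnetic billiard trajectory in $U$ with magnetic curvature $a\in\mathbb R$ is a unit-speed curve in $U$ consisting of circular arcs of constant signed curvature $a$ (straight segments if $a=0$), the same for all arcs, reflecting at $\partial U$ by the usual law (angle of incidence equals angle of reflection). *)

theory Defs
  imports "HOL-Analysis.Analysis"
begin

text \<open>Coordinates on \<open>\<real>\<^sup>3\<close> are \<open>x = q$1\<close>, \<open>y = q$2\<close>, \<open>z = q$3\<close>.  A covector is represented by its
  canonical coordinates \<open>(p\<^sub>x, p\<^sub>y, p\<^sub>z)\<close>, so that the pairing of a covector with a vector is
  \<open>(\<bullet>)\<close> and \<open>T\<^sup>*\<real>\<^sup>3\<close> is \<open>\<real>\<^sup>3 \<times> \<real>\<^sup>3\<close> with its canonical symplectic structure.\<close>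

abbreviation dx :: "real^3" where "dx \<equiv> axis 1 1"
abbreviation dy :: "real^3" where "dy \<equiv> axis 2 1"
abbreviation dz :: "real^3" where "dz \<equiv> axis 3 1"

definition alpha_std :: "real^3 \<Rightarrow> real^3" where
  "alpha_std q = dz - (1/2) *\<^sub>R (q$1 *\<^sub>R dy - q$2 *\<^sub>R dx)"

definition xi_std :: "real^3 \<Rightarrow> (real^3) set" where
  "xi_std q = {v. alpha_std q \<bullet> v = 0}"

definition g_std :: "real^3 \<Rightarrow> real^3 \<Rightarrow> real" where
  "g_std v w = (dx \<bullet> v) * (dx \<bullet> w) + (dy \<bullet> v) * (dy \<bullet> w)"

text \<open>The coefficients of a covector \<open>a \<alpha> + b dx + c dy\<close> at \<open>q\<close>; see \<open>covector_coords\<close> below.\<close>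

definition momentum :: "real^3 \<Rightarrow> real" where
  "momentum p = p$3"

definition coeff_dx :: "real^3 \<Rightarrow> real^3 \<Rightarrow> real" where
  "coeff_dx q p = p$1 - p$3 * q$2 / 2"

definition coeff_dy :: "real^3 \<Rightarrow> real^3 \<Rightarrow> real" where
  "coeff_dy q p = p$2 + p$3 * q$1 / 2"

lemma covector_coords:
  "p = a *\<^sub>R alpha_std q + b *\<^sub>R dx + c *\<^sub>R dy \<longleftrightarrow>
     a = momentum p \<and> b = coeff_dx q p \<and> c = coeff_dy q p"
  by (auto simp: alpha_std_def momentum_def coeff_dx_def coeff_dy_def vec_eq_iff forall_3
      axis_def algebra_simps)

definition ham :: "real^3 \<Rightarrow> real^3 \<Rightarrow> real" where
  "ham q p = sqrt ((coeff_dx q p)\<^sup>2 + (coeff_dy q p)\<^sup>2)"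

definition unit_covectors :: "real^3 \<Rightarrow> (real^3) set" where
  "unit_covectors q = {p. (coeff_dx q p)\<^sup>2 + (coeff_dy q p)\<^sup>2 = 1}"

lemma ham_dual_norm:
  "ham q p = (SUP v\<in>{v \<in> xi_std q. g_std v v = 1}. p \<bullet> v)"
proof -
  define b c where "b = coeff_dx q p" and "c = coeff_dy q p"
  have g: "g_std v v = (v$1)\<^sup>2 + (v$2)\<^sup>2" for v
    by (simp add: g_std_def inner_axis' power2_eq_square)
  have xi: "v \<in> xi_std q \<longleftrightarrow> v$3 = (q$1 * v$2 - q$2 * v$1) / 2" for v
    by (auto simp: xi_std_def alpha_std_def inner_vec_def sum_3 axis_def field_simps)
  have pair: "p \<bullet> v = b * v$1 + c * v$2" if "v \<in> xi_std q" for v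
  proof -
    have v3: "v$3 = (q$1 * v$2 - q$2 * v$1) / 2" using that xi by blast
    show ?thesis
      unfolding b_def c_def coeff_dx_def coeff_dy_def inner_vec_def sum_3 v3
      by (simp add: field_simps)
  qed
  define r where "r = sqrt (b\<^sup>2 + c\<^sup>2)"
  obtain s t where st: "s\<^sup>2 + t\<^sup>2 = 1" "b * s + c * t = r"
  proof (cases "r = 0")
    case True
    then have "b = 0" "c = 0" by (auto simp: r_def)
    then show ?thesis using True that[of 1 0] by simp
  next
    case False
    have r2: "r\<^sup>2 = b\<^sup>2 + c\<^sup>2" by (simp add: r_def)
    show ?thesis
    proof (rule that[of "b/r" "c/r"])
      show "(b/r)\<^sup>2 + (c/r)\<^sup>2 = 1"
        using False unfolding power_divide add_divide_distrib[symmetric] r2[symmetric] by simp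
      show "b * (b/r) + c * (c/r) = r"
        using False r2 by (simp add: power2_eq_square field_simps)
    qed
  qed
  define w :: "real^3" where "w = vector [s, t, (q$1 * t - q$2 * s) / 2]"
  have w: "w \<in> xi_std q" "g_std w w = 1" "p \<bullet> w = r"
  proof -
    show w1: "w \<in> xi_std q" by (simp add: xi w_def)
    show "g_std w w = 1" using st by (simp add: g w_def)
    show "p \<bullet> w = r" using st pair[OF w1] by (simp add: w_def)
  qed
  have "p \<bullet> v \<le> r" if "v \<in> xi_std q" "g_std v v = 1" for v
  proof -
    have "(b * v$1 + c * v$2)\<^sup>2 + (b * v$2 - c * v$1)\<^sup>2 = (b\<^sup>2 + c\<^sup>2) * ((v$1)\<^sup>2 + (v$2)\<^sup>2)"
      by algebra
    then have "(b * v$1 + c * v$2)\<^sup>2 \<le> b\<^sup>2 + c\<^sup>2"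
      using that(2) unfolding g by (smt (verit) mult_cancel_left1 zero_le_power2)
    then show ?thesis
      unfolding r_def pair[OF that(1)] by (rule real_le_rsqrt)
  qed
  then have "(SUP v\<in>{v \<in> xi_std q. g_std v v = 1}. p \<bullet> v) = r"
    using w by (intro cSup_eq_maximum) auto
  then show ?thesis by (simp add: ham_def r_def b_def c_def)
qed

text \<open>Hamilton's equations \<open>q' = \<partial>F/\<partial>p\<close>, \<open>p' = - \<partial>F/\<partial>q\<close> on the time interval \<open>J\<close>.\<close>

definition hamiltonian_orbit ::
  "(real^3 \<Rightarrow> real^3 \<Rightarrow> real) \<Rightarrow> real set \<Rightarrow> (real \<Rightarrow> real^3) \<Rightarrow> (real \<Rightarrow> real^3) \<Rightarrow> bool" where
  "hamiltonian_orbit F J q p \<longleftrightarrow>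
     (\<forall>t\<in>J. \<exists>q' p'.
        (q has_vector_derivative q') (at t within J) \<and>
        (p has_vector_derivative p') (at t within J) \<and>
        GDERIV (\<lambda>w. F (q t) w) (p t) :> q' \<and>
        GDERIV (\<lambda>u. F u (p t)) (q t) :> - p')"

text \<open>\<open>q\<close> is a geodesic parametrised by arclength on \<open>J\<close>, with momentum covectors \<open>p\<close>.\<close>

definition geodesic :: "real set \<Rightarrow> (real \<Rightarrow> real^3) \<Rightarrow> (real \<Rightarrow> real^3) \<Rightarrow> bool" where
  "geodesic J q p \<longleftrightarrow> hamiltonian_orbit ham J q p \<and> (\<forall>t\<in>J. p t \<in> unit_covectors (q t))"

fun Ck_on :: "nat \<Rightarrow> 'a::euclidean_space set \<Rightarrow> ('a \<Rightarrow> real) \<Rightarrow> bool" where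
  "Ck_on 0 N f \<longleftrightarrow> continuous_on N f"
| "Ck_on (Suc k) N f \<longleftrightarrow>
     (\<forall>x\<in>N. f differentiable (at x)) \<and>
     (\<forall>v. Ck_on k N (\<lambda>x. frechet_derivative f (at x) v))"

definition smooth_on :: "'a::euclidean_space set \<Rightarrow> ('a \<Rightarrow> real) \<Rightarrow> bool" where
  "smooth_on N f \<longleftrightarrow> (\<forall>k. Ck_on k N f)"

text \<open>\<open>f\<close> is a defining function of \<open>W\<close> on the open neighbourhood \<open>N\<close> of the boundary point \<open>q\<close>:
  \<open>W\<close> is locally a regular sublevel set.\<close>

definition defining_function ::
  "'a::euclidean_space set \<Rightarrow> 'a \<Rightarrow> 'a set \<Rightarrow> ('a \<Rightarrow> real) \<Rightarrow> bool" where
  "defining_function W q N f \<longleftrightarrow>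
     open N \<and> q \<in> N \<and> smooth_on N f \<and> f q = 0 \<and>
     (\<forall>x\<in>N. frechet_derivative f (at x) \<noteq> (\<lambda>_. 0)) \<and>
     W \<inter> N = {x\<in>N. f x \<le> 0}"

definition billiard_table :: "'a::euclidean_space set \<Rightarrow> bool" where
  "billiard_table W \<longleftrightarrow>
     interior W \<noteq> {} \<and> connected (interior W) \<and> closure (interior W) = W \<and>
     (\<forall>q\<in>frontier W. \<exists>N f. defining_function W q N f)"

text \<open>The tangent space of the boundary at \<open>q\<close> is the kernel of the differential of a defining
  function; the kernel does not depend on the choice of that function.\<close>

definition tangent_boundary :: "'a::euclidean_space set \<Rightarrow> 'a \<Rightarrow> 'a set" where
  "tangent_boundary W q =
     {v. \<exists>N f. defining_function W q N f \<and> frechet_derivative f (at q) v = 0}"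

definition annihilator :: "(real^3) set \<Rightarrow> (real^3) set" where
  "annihilator V = {p. \<forall>v\<in>V. p \<bullet> v = 0}"

text \<open>\<open>I\<close> is the time interval of a trajectory and \<open>T\<close> its set of reflection times.  Between
  consecutive reflection times lie the segments, i.e. the connected components of \<open>I - T\<close>.\<close>

definition reflection_times :: "real set \<Rightarrow> real set \<Rightarrow> bool" where
  "reflection_times I T \<longleftrightarrow>
     is_interval I \<and> interior I \<noteq> {} \<and> T \<subseteq> interior I \<and>
     (\<forall>K. compact K \<and> K \<subseteq> I \<longrightarrow> finite (K \<inter> T))"

text \<open>The momentum covector \<open>p\<close> is only constrained on \<open>I - T\<close>; the ingoing and outgoing
  covectors at a reflection time are its one-sided limits.\<close>

definition billiard_trajectory ::
  "(real^3) set \<Rightarrow> real set \<Rightarrow> real set \<Rightarrow> (real \<Rightarrow> real^3) \<Rightarrow> (real \<Rightarrow> real^3) \<Rightarrow> bool" where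
  "billiard_trajectory W I T \<gamma> p \<longleftrightarrow>
     reflection_times I T \<and> continuous_on I \<gamma> \<and> \<gamma> ` I \<subseteq> W \<and>
     (\<forall>J\<in>components (I - T). geodesic J \<gamma> p) \<and>
     (\<forall>t\<in>T. \<gamma> t \<in> frontier W \<and>
        (\<exists>p_in p_out. (p \<longlongrightarrow> p_in) (at_left t) \<and> (p \<longlongrightarrow> p_out) (at_right t) \<and>
           p_in \<in> unit_covectors (\<gamma> t) \<and> p_out \<in> unit_covectors (\<gamma> t) \<and> p_in \<noteq> p_out \<and>
           p_in - p_out \<in> annihilator (tangent_boundary W (\<gamma> t))))"

text \<open>A circular arc (straight segment if \<open>a = 0\<close>) of signed curvature \<open>a\<close>, traversed with unit
  speed.  The signed curvature of a unit-speed planar curve is \<open>det (\<eta>', \<eta>'')\<close>; it is positive for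
  counterclockwise motion.\<close>

definition circular_arc :: "real \<Rightarrow> real set \<Rightarrow> (real \<Rightarrow> real^2) \<Rightarrow> bool" where
  "circular_arc a J \<eta> \<longleftrightarrow>
     (\<exists>\<eta>' \<eta>''. \<forall>t\<in>J.
        (\<eta> has_vector_derivative \<eta>' t) (at t within J) \<and>
        (\<eta>' has_vector_derivative \<eta>'' t) (at t within J) \<and>
        norm (\<eta>' t) = 1 \<and>
        \<eta>' t $ 1 * \<eta>'' t $ 2 - \<eta>' t $ 2 * \<eta>'' t $ 1 = a) \<and>
     (if a = 0 then \<exists>u v. \<forall>t\<in>J. \<exists>s. \<eta> t = u + s *\<^sub>R v
      else \<exists>c. \<forall>t\<in>J. dist c (\<eta> t) = 1 / \<bar>a\<bar>)"

text \<open>Equality of the angles of incidence and reflection: the tangential component of the velocity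
  is kept and the normal component is reversed.  Since \<open>v_in \<noteq> v_out\<close>, grazing is not a reflection.\<close>

definition reflects :: "(real^2) set \<Rightarrow> real^2 \<Rightarrow> real^2 \<Rightarrow> real^2 \<Rightarrow> bool" where
  "reflects U w v_in v_out \<longleftrightarrow>
     v_in \<noteq> v_out \<and>
     (\<exists>n. norm n = 1 \<and> (\<forall>\<tau>\<in>tangent_boundary U w. n \<bullet> \<tau> = 0) \<and>
        v_out = v_in - (2 * (v_in \<bullet> n)) *\<^sub>R n)"

definition magnetic_billiard_trajectory ::
  "(real^2) set \<Rightarrow> real set \<Rightarrow> real set \<Rightarrow> real \<Rightarrow> (real \<Rightarrow> real^2) \<Rightarrow> bool" where
  "magnetic_billiard_trajectory U I T a \<eta> \<longleftrightarrow>
     reflection_times I T \<and> continuous_on I \<eta> \<and> \<eta> ` I \<subseteq> U \<and>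
     (\<forall>J\<in>components (I - T). circular_arc a J \<eta>) \<and>
     (\<forall>t\<in>T. \<eta> t \<in> frontier U \<and>
        (\<exists>v_in v_out. (\<eta> has_vector_derivative v_in) (at_left t) \<and>
           (\<eta> has_vector_derivative v_out) (at_right t) \<and> reflects U (\<eta> t) v_in v_out))"

definition lagr_proj :: "real^3 \<Rightarrow> real^2" where
  "lagr_proj q = vector [q$1, q$2]"

definition cylinder :: "(real^2) set \<Rightarrow> (real^3) set" where
  "cylinder U = {q. lagr_proj q \<in> U}"

text \<open>\<open>\<gamma>\<close> is a lift of the planar curve \<open>\<eta>\<close>: it projects to \<open>\<eta>\<close> and each of its segments is tangent
  to \<open>xi_std\<close>.\<close>

definition lift_of ::
  "real set \<Rightarrow> real set \<Rightarrow> (real \<Rightarrow> real^3) \<Rightarrow> (real \<Rightarrow> real^2) \<Rightarrow> bool" where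
  "lift_of I T \<gamma> \<eta> \<longleftrightarrow>
     continuous_on I \<gamma> \<and> (\<forall>t\<in>I. lagr_proj (\<gamma> t) = \<eta> t) \<and>
     (\<forall>J\<in>components (I - T). \<forall>t\<in>J.
        \<exists>v\<in>xi_std (\<gamma> t). (\<gamma> has_vector_derivative v) (at t within J))"

end

theory Submission
  imports Defs
begin

text \<open>Along a geodesic with momentum \<open>a\<close>, Hamilton's equations say that \<open>a\<close> is constant and that
  the planar velocity \<open>v = (b, c)\<close> of the projection satisfies \<open>v' = a R v\<close>, where \<open>R\<close> is the
  rotation by a right angle; so the projection is a unit-speed arc of curvature \<open>a\<close>.  The boundary
  of the cylinder contains the direction \<open>\<partial>\<^sub>z\<close>, so the reflection law forces \<open>p_in - p_out\<close> to have
  vanishing \<open>dz\<close> component: the momentum survives reflections, and the remaining part of the law says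
  that \<open>v_in - v_out\<close> is normal to the boundary of \<open>U\<close>, which for unit vectors is the law of equal
  angles.\<close>

section \<open>Planar velocity of a covector and rotation by a right angle\<close>

definition quarter_turn :: "real^2 \<Rightarrow> real^2" where
  "quarter_turn v = vector [- v$2, v$1]"

text \<open>The coefficients \<open>(b, c)\<close> are also the first two entries of the gradient of
  \<open>ham\<close> in the covector, as long as the covector is a unit one. Along a geodesic this
  vector is therefore the velocity of the projected curve.\<close>

definition planar_velocity :: "real^3 \<Rightarrow> real^3 \<Rightarrow> real^2" where
  "planar_velocity q p = vector [coeff_dx q p, coeff_dy q p]"

lemma bounded_linear_lagr_proj: "bounded_linear lagr_proj"
  by (intro linear_conv_bounded_linear[THEN iffD1] linearI)
    (auto simp: lagr_proj_def vec_eq_iff forall_2)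

lemma bounded_linear_quarter_turn: "bounded_linear quarter_turn"
  by (intro linear_conv_bounded_linear[THEN iffD1] linearI)
    (auto simp: quarter_turn_def vec_eq_iff forall_2)

text \<open>This form separates the linear dependence on \<open>p\<close> from the product of
  momentum and position. It allows differentiation by the product rule, passage to limits, and
  cancellation of the position term when two covectors at \<open>q\<close> have the same
  momentum.\<close>

lemma planar_velocity_eq:
  "planar_velocity q p = lagr_proj p + (momentum p / 2) *\<^sub>R quarter_turn (lagr_proj q)"
  by (simp add: planar_velocity_def coeff_dx_def coeff_dy_def momentum_def lagr_proj_def
      quarter_turn_def vec_eq_iff forall_2)

lemma norm_real2: "norm (v::real^2) = sqrt ((v$1)\<^sup>2 + (v$2)\<^sup>2)"
  by (simp add: norm_vec_def L2_set_def sum_2)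

lemma unit_covectors_iff_norm_planar_velocity:
  "p \<in> unit_covectors q \<longleftrightarrow> norm (planar_velocity q p) = 1"
  by (simp add: norm_real2 planar_velocity_def unit_covectors_def)

lemma norm_quarter_turn [simp]: "norm (quarter_turn v) = norm v"
  by (simp add: norm_real2 quarter_turn_def add.commute)

lemma quarter_turn_quarter_turn [simp]: "quarter_turn (quarter_turn v) = - v"
  by (simp add: quarter_turn_def vec_eq_iff forall_2)

section \<open>Gradients of the Hamiltonian and Hamilton's equations\<close>

lemma GDERIV_unique:
  assumes "GDERIV f x :> D" "GDERIV f x :> E"
  shows "D = E"
proof -
  have "(\<lambda>h. h \<bullet> D) = (\<lambda>h. h \<bullet> E)"
    using assms unfolding gderiv_def by (rule has_derivative_unique)
  then show ?thesis
    by (simp add: fun_eq_iff vector_eq_ldot)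
qed

text \<open>At a point where the sum of squares is 1, the square root has derivative 1/2, which
  cancels the factor 2 from the squares and leaves no denominator.\<close>

lemma has_derivative_sqrt_sum_squares:
  fixes f g :: "'a::real_normed_vector \<Rightarrow> real"
  assumes f: "(f has_derivative f') (at x)" and g: "(g has_derivative g') (at x)"
    and "(f x)\<^sup>2 + (g x)\<^sup>2 = 1"
  shows "((\<lambda>w. sqrt ((f w)\<^sup>2 + (g w)\<^sup>2)) has_derivative (\<lambda>h. f x * f' h + g x * g' h)) (at x)"
proof -
  have "((\<lambda>w. (f w)\<^sup>2 + (g w)\<^sup>2) has_derivative (\<lambda>h. 2 * (f x * f' h + g x * g' h))) (at x)"
    by (rule derivative_eq_intros f g refl)+ (simp add: algebra_simps fun_eq_iff)
  moreover have "(sqrt has_derivative (\<lambda>h. h / 2)) (at ((f x)\<^sup>2 + (g x)\<^sup>2))"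
  proof -
    have "(*) (1 / 2) = (\<lambda>h::real. h / 2)" by auto
    then show ?thesis
      using DERIV_real_sqrt[of 1] assms(3) by (simp add: has_field_derivative_def)
  qed
  ultimately show ?thesis
    by (rule has_derivative_compose[of _ _ x UNIV sqrt, THEN has_derivative_eq_rhs]) auto
qed

lemmas has_derivative_nth = bounded_linear_imp_has_derivative[OF bounded_linear_vec_nth]

lemma gderiv_ham_covector:
  assumes "p \<in> unit_covectors q"
  shows "GDERIV (\<lambda>w. ham q w) p :> vector [coeff_dx q p, coeff_dy q p,
           (q$1 * coeff_dy q p - q$2 * coeff_dx q p) / 2]"
proof -
  have "((\<lambda>w. coeff_dx q w) has_derivative (\<lambda>h. h$1 - h$3 * q$2 / 2)) (at p)"
    "((\<lambda>w. coeff_dy q w) has_derivative (\<lambda>h. h$2 + h$3 * q$1 / 2)) (at p)"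
    unfolding coeff_dx_def coeff_dy_def
    by (rule derivative_eq_intros has_derivative_nth refl | simp)+
  note has_derivative_sqrt_sum_squares[OF this]
  moreover have "(coeff_dx q p)\<^sup>2 + (coeff_dy q p)\<^sup>2 = 1"
    using assms by (simp add: unit_covectors_def)
  moreover have "coeff_dx q p * (h$1 - h$3 * q$2 / 2) + coeff_dy q p * (h$2 + h$3 * q$1 / 2) =
      h \<bullet> vector [coeff_dx q p, coeff_dy q p, (q$1 * coeff_dy q p - q$2 * coeff_dx q p) / 2]" for h :: "real^3"
    by (simp add: inner_vec_def sum_3 field_simps)
  ultimately show ?thesis
    by (simp add: gderiv_def ham_def)
qed

text \<open>Neither \<open>coeff_dx\<close> nor \<open>coeff_dy\<close> involves z. The resulting
  zero in the third entry is what makes the momentum a conserved quantity.\<close>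

lemma gderiv_ham_point:
  assumes "p \<in> unit_covectors q"
  shows "GDERIV (\<lambda>u. ham u p) q :> vector [momentum p * coeff_dy q p / 2,
           - (momentum p * coeff_dx q p / 2), 0]"
proof -
  have "((\<lambda>u. coeff_dx u p) has_derivative (\<lambda>h. - (p$3 * h$2 / 2))) (at q)"
    "((\<lambda>u. coeff_dy u p) has_derivative (\<lambda>h. p$3 * h$1 / 2)) (at q)"
    unfolding coeff_dx_def coeff_dy_def
    by (rule derivative_eq_intros has_derivative_nth refl | simp)+
  note has_derivative_sqrt_sum_squares[OF this]
  moreover have "(coeff_dx q p)\<^sup>2 + (coeff_dy q p)\<^sup>2 = 1"
    using assms by (simp add: unit_covectors_def)
  moreover have "coeff_dx q p * - (p$3 * h$2 / 2) + coeff_dy q p * (p$3 * h$1 / 2) =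
      h \<bullet> vector [momentum p * coeff_dy q p / 2, - (momentum p * coeff_dx q p / 2), 0]" for h :: "real^3"
    by (simp add: inner_vec_def sum_3 momentum_def field_simps)
  ultimately show ?thesis
    by (simp add: gderiv_def ham_def)
qed

lemma geodesic_has_vector_derivative:
  assumes "geodesic J q p" "t \<in> J"
  shows "(q has_vector_derivative vector [coeff_dx (q t) (p t), coeff_dy (q t) (p t),
           (q t$1 * coeff_dy (q t) (p t) - q t$2 * coeff_dx (q t) (p t)) / 2]) (at t within J)"
    and "(p has_vector_derivative vector [- (momentum (p t) * coeff_dy (q t) (p t) / 2),
           momentum (p t) * coeff_dx (q t) (p t) / 2, 0]) (at t within J)"
proof -
  have u: "p t \<in> unit_covectors (q t)"
    using assms by (simp add: geodesic_def)
  \<comment> \<open>An orbit is only required to have some derivatives that match the gradients;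
    uniqueness of gradients then identifies them with the explicit vectors.\<close>
  obtain q' p' where d: "(q has_vector_derivative q') (at t within J)"
      "(p has_vector_derivative p') (at t within J)"
      "GDERIV (\<lambda>w. ham (q t) w) (p t) :> q'" "GDERIV (\<lambda>u. ham u (p t)) (q t) :> - p'"
    using assms unfolding geodesic_def hamiltonian_orbit_def by blast
  show "(q has_vector_derivative vector [coeff_dx (q t) (p t), coeff_dy (q t) (p t),
           (q t$1 * coeff_dy (q t) (p t) - q t$2 * coeff_dx (q t) (p t)) / 2]) (at t within J)"
    using d(1) GDERIV_unique[OF d(3) gderiv_ham_covector[OF u]] by simp
  have "p' = vector [- (momentum (p t) * coeff_dy (q t) (p t) / 2),
           momentum (p t) * coeff_dx (q t) (p t) / 2, 0]"
    using GDERIV_unique[OF d(4) gderiv_ham_point[OF u]]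
    by (simp add: vec_eq_iff forall_3 minus_equation_iff)
  then show "(p has_vector_derivative vector [- (momentum (p t) * coeff_dy (q t) (p t) / 2),
           momentum (p t) * coeff_dx (q t) (p t) / 2, 0]) (at t within J)"
    using d(2) by simp
qed

section \<open>Pulling back defining functions along linear surjections\<close>

lemma Ck_on_cong:
  assumes "open N" "\<And>x. x \<in> N \<Longrightarrow> f x = g x" "Ck_on k N f"
  shows "Ck_on k N g"
  using assms(2,3)
proof (induction k arbitrary: f g)
  case 0
  then show ?case using continuous_on_cong[of N N f g] by simp
next
  case (Suc k)
  have D: "(g has_derivative frechet_derivative f (at x)) (at x)" if "x \<in> N" for x
  proof (rule has_derivative_transform_within_open[OF _ \<open>open N\<close> that])
    show "(f has_derivative frechet_derivative f (at x)) (at x)"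
      using Suc.prems that by (simp add: frechet_derivative_works[symmetric])
  qed (use Suc.prems in auto)
  have "Ck_on k N (\<lambda>x. frechet_derivative g (at x) v)" for v
  proof (rule Suc.IH)
    show "Ck_on k N (\<lambda>x. frechet_derivative f (at x) v)"
      using Suc.prems by simp
    show "frechet_derivative f (at x) v = frechet_derivative g (at x) v" if "x \<in> N" for x
      using frechet_derivative_at[OF D[OF that]] by simp
  qed
  with D show ?case by (auto simp: differentiable_def)
qed

lemma frechet_derivative_compose_linear:
  assumes "bounded_linear L" "f differentiable (at (L x))"
  shows "((\<lambda>x. f (L x)) has_derivative (\<lambda>v. frechet_derivative f (at (L x)) (L v))) (at x)"
    and "frechet_derivative (\<lambda>x. f (L x)) (at x) = (\<lambda>v. frechet_derivative f (at (L x)) (L v))"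
proof -
  show D: "((\<lambda>x. f (L x)) has_derivative (\<lambda>v. frechet_derivative f (at (L x)) (L v))) (at x)"
    by (rule has_derivative_compose[of L L x UNIV f])
       (use assms in \<open>auto intro: bounded_linear_imp_has_derivative simp: frechet_derivative_works[symmetric]\<close>)
  show "frechet_derivative (\<lambda>x. f (L x)) (at x) = (\<lambda>v. frechet_derivative f (at (L x)) (L v))"
    using frechet_derivative_at[OF D] by simp
qed

lemma open_vimage_bounded_linear: "bounded_linear L \<Longrightarrow> open N \<Longrightarrow> open (L -` N)"
  by (simp add: continuous_open_vimage linear_continuous_at)

text \<open>The derivative of the composition in direction \<open>v\<close> is the derivative of
  \<open>f\<close> in the fixed direction \<open>L v\<close>, again composed with \<open>L\<close>.
  Hence the induction hypothesis applies directly, without a product rule.\<close>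

lemma Ck_on_compose_linear:
  fixes L :: "'a::euclidean_space \<Rightarrow> 'b::euclidean_space"
  assumes L: "bounded_linear L" and "open N" "Ck_on k N f"
  shows "Ck_on k (L -` N) (\<lambda>x. f (L x))"
  using assms(3)
proof (induction k arbitrary: f)
  case 0
  then show ?case
    by (auto intro!: continuous_on_compose2[OF _ linear_continuous_on[OF L]])
next
  case (Suc k)
  have d: "f differentiable (at (L x))" if "x \<in> L -` N" for x
    using Suc.prems that by simp
  have "Ck_on k (L -` N) (\<lambda>x. frechet_derivative (\<lambda>x. f (L x)) (at x) v)" for v
  \<comment> \<open>The chain rule identifies the two derivatives only on the open preimage of
    \<open>N\<close>, so regularity is transported along an equality on that set.\<close>
  proof (rule Ck_on_cong[OF open_vimage_bounded_linear[OF L \<open>open N\<close>]])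
    show "Ck_on k (L -` N) (\<lambda>x. frechet_derivative f (at (L x)) (L v))"
      using Suc.IH[of "\<lambda>y. frechet_derivative f (at y) (L v)"] Suc.prems by simp
    show "frechet_derivative f (at (L x)) (L v) = frechet_derivative (\<lambda>x. f (L x)) (at x) v"
      if "x \<in> L -` N" for x
      using frechet_derivative_compose_linear(2)[OF L d[OF that]] by simp
  qed
  moreover have "(\<lambda>x. f (L x)) differentiable (at x)" if "x \<in> L -` N" for x
    using frechet_derivative_compose_linear(1)[OF L d[OF that]] by (auto simp: differentiable_def)
  ultimately show ?case by simp
qed

text \<open>Surjectivity of \<open>L\<close> preserves regularity: a direction on which the
  differential of \<open>f\<close> is nonzero has a preimage under \<open>L\<close>.\<close>

lemma defining_function_vimage:
  fixes L :: "'a::euclidean_space \<Rightarrow> 'b::euclidean_space"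
  assumes L: "bounded_linear L" "surj L" and f: "defining_function U (L q) N f"
  shows "defining_function (L -` U) q (L -` N) (\<lambda>x. f (L x))"
    and "frechet_derivative (\<lambda>x. f (L x)) (at q) v = frechet_derivative f (at (L q)) (L v)"
proof -
  have d: "f differentiable (at y)" if "y \<in> N" for y
  proof -
    have "Ck_on 1 N f" using f unfolding defining_function_def smooth_on_def by blast
    then show ?thesis using that by simp
  qed
  have "frechet_derivative (\<lambda>x. f (L x)) (at x) \<noteq> (\<lambda>_. 0)" if x: "L x \<in> N" for x
  proof -
    obtain w where "frechet_derivative f (at (L x)) w \<noteq> 0"
      using f x unfolding defining_function_def by fastforce
    moreover obtain v where "w = L v" using L(2) by (rule surjE)
    ultimately show ?thesis
      using frechet_derivative_compose_linear(2)[OF L(1) d[OF x]] by metis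
  qed
  then show "defining_function (L -` U) q (L -` N) (\<lambda>x. f (L x))"
    using f open_vimage_bounded_linear[OF L(1)] Ck_on_compose_linear[OF L(1)]
    unfolding defining_function_def smooth_on_def by auto
  show "frechet_derivative (\<lambda>x. f (L x)) (at q) v = frechet_derivative f (at (L q)) (L v)"
    using f frechet_derivative_compose_linear(2)[OF L(1) d] by (simp add: defining_function_def)
qed

section \<open>Boundary and tangent spaces of the cylinder\<close>

lemma surj_lagr_proj: "surj lagr_proj"
proof (rule surjI)
  show "lagr_proj (vector [v$1, v$2, 0]) = v" for v
    by (simp add: lagr_proj_def vec_eq_iff forall_2)
qed

lemma cylinder_eq_vimage: "cylinder U = lagr_proj -` U"
  by (auto simp: cylinder_def)

text \<open>A defining function of \<open>U\<close> pulls back to one of the cylinder. This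
  inclusion suffices for the reflection law, since a covector that annihilates the larger set
  annihilates the smaller one.\<close>

lemma tangent_boundary_cylinder:
  assumes "lagr_proj v \<in> tangent_boundary U (lagr_proj q)"
  shows "v \<in> tangent_boundary (cylinder U) q"
proof -
  obtain N f where f: "defining_function U (lagr_proj q) N f"
    "frechet_derivative f (at (lagr_proj q)) (lagr_proj v) = 0"
    using assms unfolding tangent_boundary_def by blast
  note D = defining_function_vimage[OF bounded_linear_lagr_proj surj_lagr_proj f(1)]
  show ?thesis
    unfolding tangent_boundary_def cylinder_eq_vimage using D(1) D(2)[of v] f(2) by auto
qed

text \<open>The point is the existence of a defining function: \<open>tangent_boundary\<close> would
  be empty without one. Vertical directions, which project to 0, thereby become tangent to the
  boundary of the cylinder.\<close>

lemma zero_in_tangent_boundary: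
  assumes "billiard_table U" "q \<in> frontier U"
  shows "0 \<in> tangent_boundary U q"
proof -
  obtain N f where f: "defining_function U q N f"
    using assms unfolding billiard_table_def by blast
  then have "Ck_on 1 N f" "q \<in> N"
    unfolding defining_function_def smooth_on_def by blast+
  then have "f differentiable (at q)" by simp
  then have "frechet_derivative f (at q) 0 = 0"
    by (simp add: linear_frechet_derivative linear_0)
  then show ?thesis
    using f unfolding tangent_boundary_def by blast
qed

lemma frontier_cylinder:
  assumes "q \<in> frontier (cylinder U)"
  shows "lagr_proj q \<in> frontier U"
proof -
  have "closed (lagr_proj -` closure U)"
    by (simp add: bounded_linear_lagr_proj continuous_closed_vimage linear_continuous_at)
  then have "closure (cylinder U) \<subseteq> lagr_proj -` closure U"
    unfolding cylinder_eq_vimage using closure_subset[of U] by (intro closure_minimal) auto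
  moreover have "lagr_proj -` interior U \<subseteq> interior (cylinder U)"
    unfolding cylinder_eq_vimage using interior_subset[of U]
    by (intro interior_maximal open_vimage_bounded_linear[OF bounded_linear_lagr_proj]) auto
  ultimately show ?thesis
    using assms by (auto simp: frontier_def)
qed

section \<open>One-sided derivatives as limits of derivatives\<close>

lemma has_vector_derivative_limit:
  fixes f :: "real \<Rightarrow> 'a::real_inner"
  assumes S: "convex S" "t \<in> S" and cont: "continuous_on S f"
    and deriv: "\<And>s. s \<in> S - {t} \<Longrightarrow> (f has_vector_derivative f' s) (at s)"
    and lim: "(f' \<longlongrightarrow> l) (at t within S)"
  shows "(f has_vector_derivative l) (at t within S)"
  unfolding has_vector_derivative_def has_derivative_within_alt
proof (intro conjI allI impI)
  show "bounded_linear (\<lambda>x. x *\<^sub>R l)" by (rule bounded_linear_scaleR_left)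
  fix e :: real assume "e > 0"
  then obtain d where d: "d > 0" "\<And>s. s \<in> S \<Longrightarrow> s \<noteq> t \<Longrightarrow> dist s t < d \<Longrightarrow> dist (f' s) l < e"
    using lim unfolding Lim_within by (metis dist_pos_lt)
  \<comment> \<open>This is the mean value inequality for \<open>f s - s l\<close>. As
    \<open>t\<close> is an endpoint of \<open>[a, b]\<close>, the intermediate point differs from
    \<open>t\<close>, so the derivative is known there and lies within \<open>e\<close> of
    \<open>l\<close>. Both orders of \<open>t\<close> and the other endpoint occur.\<close>
  have main: "norm (f b - f a - (b - a) *\<^sub>R l) \<le> e * \<bar>b - a\<bar>"
    if ab: "a < b" "a \<in> S" "b \<in> S" "a = t \<or> b = t" "\<bar>b - a\<bar> < d" for a b
  proof -
    have sub: "{a..b} \<subseteq> S"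
      using S(1) ab by (metis convex_contains_segment closed_segment_eq_real_ivl1 less_imp_le)
    have D: "((\<lambda>s. f s - s *\<^sub>R l) has_vector_derivative (f' s - l)) (at s)" if "s \<in> {a<..<b}" for s
      using that sub ab by (auto intro!: derivative_eq_intros deriv)
    obtain s where s: "s \<in> {a<..<b}"
      "norm ((f b - b *\<^sub>R l) - (f a - a *\<^sub>R l)) \<le> norm ((b - a) *\<^sub>R (f' s - l))"
    proof (rule bexE[OF mvt_general[of a b "\<lambda>s. f s - s *\<^sub>R l" "\<lambda>s h. h *\<^sub>R (f' s - l)"]])
      show "continuous_on {a..b} (\<lambda>s. f s - s *\<^sub>R l)"
        by (intro continuous_intros continuous_on_subset[OF cont sub])
    qed (use ab D in \<open>auto simp: has_vector_derivative_def\<close>)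
    have "norm (f' s - l) \<le> e"
    proof -
      have "s \<in> S" "s \<noteq> t" "dist s t < d"
        using s(1) sub ab by (auto simp: dist_real_def)
      then show ?thesis using d(2)[of s] by (simp add: dist_norm)
    qed
    then have "norm ((b - a) *\<^sub>R (f' s - l)) \<le> e * \<bar>b - a\<bar>"
      using ab(1) by (simp add: mult.commute mult_left_mono)
    moreover have "f b - b *\<^sub>R l - (f a - a *\<^sub>R l) = f b - f a - (b - a) *\<^sub>R l"
      by (simp add: algebra_simps)
    ultimately show ?thesis using s(2) by (simp only:)
  qed
  show "\<exists>d>0. \<forall>y\<in>S. norm (y - t) < d \<longrightarrow> norm (f y - f t - (y - t) *\<^sub>R l) \<le> e * norm (y - t)"
  proof (intro exI[of _ d] conjI ballI impI d(1))
    fix y assume y: "y \<in> S" "norm (y - t) < d"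
    consider "y = t" | "y < t" | "t < y" by linarith
    then show "norm (f y - f t - (y - t) *\<^sub>R l) \<le> e * norm (y - t)"
    proof cases
      case 2
      have "f y - f t - (y - t) *\<^sub>R l = - (f t - f y - (t - y) *\<^sub>R l)"
        by (simp add: algebra_simps)
      then show ?thesis
        using main[of y t] 2 y S(2) by (simp only: norm_minus_cancel) simp
    next
      case 3
      then show ?thesis using main[of t y] y S(2) by simp
    qed simp
  qed
qed

lemma has_vector_derivative_at_left_limit:
  fixes f :: "real \<Rightarrow> 'a::real_inner"
  assumes "a < t" "continuous_on {a<..t} f"
    and "\<And>s. a < s \<Longrightarrow> s < t \<Longrightarrow> (f has_vector_derivative f' s) (at s)"
    and "(f' \<longlongrightarrow> l) (at_left t)"
  shows "(f has_vector_derivative l) (at_left t)"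
proof -
  \<comment> \<open>The midpoint keeps the closed interval inside the domain of continuity, which
    excludes \<open>a\<close>, and the filter at \<open>t\<close> is still the left one.\<close>
  have eq: "at t within {(a + t) / 2..t} = at_left t"
    using assms(1) by (intro at_within_Icc_at_left) simp
  have "(f has_vector_derivative l) (at t within {(a + t) / 2..t})"
  proof (rule has_vector_derivative_limit)
    show "continuous_on {(a + t) / 2..t} f"
      using assms(1) by (auto intro: continuous_on_subset[OF assms(2)])
  qed (use assms in \<open>auto simp: eq\<close>)
  then show ?thesis by (simp only: eq)
qed

lemma has_vector_derivative_at_right_limit:
  fixes f :: "real \<Rightarrow> 'a::real_inner"
  assumes "t < b" "continuous_on {t..<b} f"
    and "\<And>s. t < s \<Longrightarrow> s < b \<Longrightarrow> (f has_vector_derivative f' s) (at s)"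
    and "(f' \<longlongrightarrow> l) (at_right t)"
  shows "(f has_vector_derivative l) (at_right t)"
proof -
  have eq: "at t within {t..(t + b) / 2} = at_right t"
    using assms(1) by (intro at_within_Icc_at_right) simp
  have "(f has_vector_derivative l) (at t within {t..(t + b) / 2})"
  proof (rule has_vector_derivative_limit)
    show "continuous_on {t..(t + b) / 2} f"
      using assms(1) by (auto intro: continuous_on_subset[OF assms(2)])
  qed (use assms in \<open>auto simp: eq\<close>)
  then show ?thesis by (simp only: eq)
qed

section \<open>Planar motion along a geodesic\<close>

lemma geodesic_planar_motion:
  assumes "geodesic J q p" "t \<in> J"
  shows "((\<lambda>s. momentum (p s)) has_real_derivative 0) (at t within J)"
    and "((\<lambda>s. lagr_proj (q s)) has_vector_derivative planar_velocity (q t) (p t)) (at t within J)"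
    and "((\<lambda>s. planar_velocity (q s) (p s)) has_vector_derivative
           momentum (p t) *\<^sub>R quarter_turn (planar_velocity (q t) (p t))) (at t within J)"
proof -
  note q' = geodesic_has_vector_derivative(1)[OF assms]
  note p' = geodesic_has_vector_derivative(2)[OF assms]
  show m: "((\<lambda>s. momentum (p s)) has_real_derivative 0) (at t within J)"
    using bounded_linear.has_vector_derivative[OF bounded_linear_vec_nth p', of 3]
    by (simp add: momentum_def has_real_derivative_iff_has_vector_derivative)
  show v: "((\<lambda>s. lagr_proj (q s)) has_vector_derivative planar_velocity (q t) (p t)) (at t within J)"
    using bounded_linear.has_vector_derivative[OF bounded_linear_lagr_proj q']
    by (simp add: planar_velocity_def lagr_proj_def)
  have "((\<lambda>s. momentum (p s) / 2) has_real_derivative 0) (at t within J)"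
    using DERIV_cdivide[OF m, of 2] by simp
  \<comment> \<open>With v the planar velocity and R the quarter turn, the projection of
    \<open>p'\<close> contributes (a/2) R v, and the moving base point contributes another (a/2) R
    v; together they give a R v.\<close>
  note has_vector_derivative_add[OF
      bounded_linear.has_vector_derivative[OF bounded_linear_lagr_proj p']
      has_vector_derivative_scaleR[OF this
        bounded_linear.has_vector_derivative[OF bounded_linear_quarter_turn v]]]
  then show "((\<lambda>s. planar_velocity (q s) (p s)) has_vector_derivative
      momentum (p t) *\<^sub>R quarter_turn (planar_velocity (q t) (p t))) (at t within J)"
    unfolding planar_velocity_eq[of "q _" "p _", abs_def]
    by (rule has_vector_derivative_eq_rhs)
      (simp add: planar_velocity_eq[symmetric],
       simp add: planar_velocity_def lagr_proj_def quarter_turn_def vec_eq_iff forall_2 field_simps)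
qed

lemma geodesic_momentum_constant:
  assumes "geodesic J q p" "connected J"
  shows "(\<lambda>t. momentum (p t)) constant_on J"
proof -
  have "convex J"
    using assms(2) by (simp add: is_interval_connected_1[symmetric] is_interval_convex_1)
  then obtain c where "\<And>t. t \<in> J \<Longrightarrow> momentum (p t) = c"
    using has_vector_derivative_zero_constant[of J "\<lambda>t. momentum (p t)"]
      geodesic_planar_motion(1)[OF assms(1)]
    by (auto simp: has_real_derivative_iff_has_vector_derivative)
  then show ?thesis by (auto simp: constant_on_def)
qed

lemma geodesic_circular_arc:
  assumes geo: "geodesic J q p" and "connected J" and a: "\<And>t. t \<in> J \<Longrightarrow> momentum (p t) = a"
  shows "circular_arc a J (lagr_proj \<circ> q)"
proof -
  define v where "v t = planar_velocity (q t) (p t)" for t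
  have J: "convex J"
    using assms(2) by (simp add: is_interval_connected_1[symmetric] is_interval_convex_1)
  have q': "((lagr_proj \<circ> q) has_vector_derivative v t) (at t within J)" if "t \<in> J" for t
    using geodesic_planar_motion(2)[OF geo that] by (simp add: v_def o_def)
  have v': "(v has_vector_derivative a *\<^sub>R quarter_turn (v t)) (at t within J)" if "t \<in> J" for t
    using geodesic_planar_motion(3)[OF geo that] a[OF that] by (simp add: v_def[abs_def])
  have nv: "norm (v t) = 1" if "t \<in> J" for t
    using geo that by (simp add: geodesic_def unit_covectors_iff_norm_planar_velocity v_def)
  \<comment> \<open>The determinant of v and a R v is a times the squared norm of v, and v is a unit
    vector.\<close>
  have curv: "v t $ 1 * (a *\<^sub>R quarter_turn (v t)) $ 2 - v t $ 2 * (a *\<^sub>R quarter_turn (v t)) $ 1 = a"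
    if "t \<in> J" for t
  proof -
    have "(v t $ 1)\<^sup>2 + (v t $ 2)\<^sup>2 = 1"
      using nv[OF that] by (simp add: norm_real2)
    moreover have "v t $ 1 * (a *\<^sub>R quarter_turn (v t)) $ 2 - v t $ 2 * (a *\<^sub>R quarter_turn (v t)) $ 1
        = a * ((v t $ 1)\<^sup>2 + (v t $ 2)\<^sup>2)"
      by (simp add: quarter_turn_def power2_eq_square algebra_simps)
    ultimately show ?thesis by simp
  qed
  have "\<exists>u w. \<forall>t\<in>J. \<exists>s. (lagr_proj \<circ> q) t = u + s *\<^sub>R w" if "a = 0"
  proof -
    have "\<And>t. t \<in> J \<Longrightarrow> (v has_vector_derivative 0) (at t within J)"
      using v' that by simp
    then obtain w where w: "\<And>t. t \<in> J \<Longrightarrow> v t = w"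
      using has_vector_derivative_zero_constant[OF J] by blast
    \<comment> \<open>With constant velocity \<open>w\<close>, subtracting \<open>t w\<close> leaves
      a constant, the base point of the line.\<close>
    have "((\<lambda>t. (lagr_proj \<circ> q) t - t *\<^sub>R w) has_vector_derivative 0) (at t within J)"
      if "t \<in> J" for t
    proof -
      have "((\<lambda>t. t *\<^sub>R w) has_vector_derivative w) (at t within J)"
        by (auto intro!: derivative_eq_intros)
      from has_vector_derivative_diff[OF q'[OF that] this] show ?thesis using w[OF that] by simp
    qed
    then obtain u where u: "\<And>t. t \<in> J \<Longrightarrow> (lagr_proj \<circ> q) t - t *\<^sub>R w = u"
      using has_vector_derivative_zero_constant[OF J] by blast
    then have "(lagr_proj \<circ> q) t = u + t *\<^sub>R w" if "t \<in> J" for t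
      using u[OF that] by (simp add: algebra_simps)
    then show ?thesis by blast
  qed
  \<comment> \<open>The centre of the circle is \<open>q + R v / a\<close>, whose derivative is \<open>v + R (R v) = 0\<close>.\<close>
  moreover have "\<exists>c. \<forall>t\<in>J. dist c ((lagr_proj \<circ> q) t) = 1 / \<bar>a\<bar>" if "a \<noteq> 0"
  proof -
    have "((\<lambda>t. (lagr_proj \<circ> q) t + (1 / a) *\<^sub>R quarter_turn (v t)) has_vector_derivative 0) (at t within J)"
      if "t \<in> J" for t
    proof -
      have "((\<lambda>t. (1 / a) *\<^sub>R quarter_turn (v t)) has_vector_derivative - v t) (at t within J)"
        using bounded_linear.has_vector_derivative[OF bounded_linear_scaleR_right
            bounded_linear.has_vector_derivative[OF bounded_linear_quarter_turn v'[OF that]], of "1 / a"] \<open>a \<noteq> 0\<close>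
        by (simp add: linear_scale[OF bounded_linear.linear[OF bounded_linear_quarter_turn]])
      from has_vector_derivative_add[OF q'[OF that] this] show ?thesis by simp
    qed
    then obtain c where c: "\<And>t. t \<in> J \<Longrightarrow> (lagr_proj \<circ> q) t + (1 / a) *\<^sub>R quarter_turn (v t) = c"
      using has_vector_derivative_zero_constant[OF J] by blast
    have "dist c ((lagr_proj \<circ> q) t) = 1 / \<bar>a\<bar>" if "t \<in> J" for t
      unfolding c[OF that, symmetric] by (simp add: dist_norm nv[OF that])
    then show ?thesis by blast
  qed
  ultimately show ?thesis
    unfolding circular_arc_def using q' v' nv curv
    by (intro conjI exI[of _ v] exI[of _ "\<lambda>t. a *\<^sub>R quarter_turn (v t)"]) auto
qed

section \<open>Isolated reflection times and constancy across them\<close>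

lemma reflection_times_isolated:
  assumes "reflection_times I T" "t \<in> I"
  obtains e where "e > 0" "\<And>s. s \<in> I \<Longrightarrow> s \<in> T \<Longrightarrow> s \<noteq> t \<Longrightarrow> e \<le> \<bar>s - t\<bar>"
proof -
  have fin: "finite (K \<inter> T)" if "compact K" "K \<subseteq> I" for K
    using assms(1) that unfolding reflection_times_def by blast
  have sub: "{a..b} \<subseteq> I" if "a \<in> I" "b \<in> I" for a b
    using assms(1) mem_is_interval_1_I[OF _ that] unfolding reflection_times_def by auto
  have near: "\<exists>e>0. \<forall>s\<in>{a..b} \<inter> T. s \<noteq> t \<longrightarrow> e \<le> \<bar>s - t\<bar>" if "a \<in> I" "b \<in> I" for a b
    using finite_set_avoid[OF fin[OF compact_Icc sub[OF that]], of t]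
    by (simp add: dist_real_def abs_minus_commute)
  \<comment> \<open>Finiteness is available only on compact subsets of \<open>I\<close>, and
    \<open>t\<close> may be an endpoint of \<open>I\<close>, so the two sides are treated
    separately. Reflection times beyond the chosen \<open>u\<close> are at distance more than
    \<open>u - t\<close>, whence the minimum.\<close>
  have right: "\<exists>e>0. \<forall>s\<in>I \<inter> T. t < s \<longrightarrow> e \<le> \<bar>s - t\<bar>"
  proof (cases "\<exists>u\<in>I. t < u")
    case True
    then obtain u where u: "u \<in> I" "t < u" by blast
    from near[OF assms(2) u(1)] obtain e where
      e: "e > 0" "\<forall>s\<in>{t..u} \<inter> T. s \<noteq> t \<longrightarrow> e \<le> \<bar>s - t\<bar>" by blast
    show ?thesis
    proof (intro exI[of _ "min e (u - t)"] conjI ballI impI)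
      fix s assume "s \<in> I \<inter> T" "t < s"
      then show "min e (u - t) \<le> \<bar>s - t\<bar>" using e(2) by (cases "s \<le> u") (auto intro: min.coboundedI1)
    qed (use e u in simp)
  qed (auto intro: exI[of _ 1])
  have left: "\<exists>e>0. \<forall>s\<in>I \<inter> T. s < t \<longrightarrow> e \<le> \<bar>s - t\<bar>"
  proof (cases "\<exists>u\<in>I. u < t")
    case True
    then obtain u where u: "u \<in> I" "u < t" by blast
    from near[OF u(1) assms(2)] obtain e where
      e: "e > 0" "\<forall>s\<in>{u..t} \<inter> T. s \<noteq> t \<longrightarrow> e \<le> \<bar>s - t\<bar>" by blast
    show ?thesis
    proof (intro exI[of _ "min e (t - u)"] conjI ballI impI)
      fix s assume "s \<in> I \<inter> T" "s < t"
      then show "min e (t - u) \<le> \<bar>s - t\<bar>" using e(2) by (cases "u \<le> s") (auto intro: min.coboundedI1)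
    qed (use e u in simp)
  qed (auto intro: exI[of _ 1])
  from right left obtain d e where "d > 0" "e > 0"
    "\<forall>s\<in>I \<inter> T. t < s \<longrightarrow> d \<le> \<bar>s - t\<bar>" "\<forall>s\<in>I \<inter> T. s < t \<longrightarrow> e \<le> \<bar>s - t\<bar>"
    by blast
  then have "min d e \<le> \<bar>s - t\<bar>" if "s \<in> I" "s \<in> T" "s \<noteq> t" for s
    using that by (cases "s < t") (auto intro: min.coboundedI1 min.coboundedI2)
  with \<open>d > 0\<close> \<open>e > 0\<close> show ?thesis by (intro that[of "min d e"]) auto
qed

lemma reflection_times_sides:
  assumes "reflection_times I T" "t \<in> T"
  obtains e where "e > 0" "{t - e<..<t + e} \<subseteq> I"
    "{t - e<..<t} \<subseteq> I - T" "{t<..<t + e} \<subseteq> I - T"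
proof -
  have "t \<in> interior I" using assms unfolding reflection_times_def by blast
  then obtain d where d: "d > 0" "ball t d \<subseteq> I" by (auto simp: mem_interior)
  then have "t \<in> I" by auto
  from reflection_times_isolated[OF assms(1) this] obtain e where
    e: "e > 0" "\<And>s. s \<in> I \<Longrightarrow> s \<in> T \<Longrightarrow> s \<noteq> t \<Longrightarrow> e \<le> \<bar>s - t\<bar>" by metis
  define m where "m = min d e"
  have m: "m > 0" "m \<le> d" "m \<le> e" using d(1) e(1) by (auto simp: m_def)
  have I: "s \<in> I" if "s \<in> {t - m<..<t + m}" for s
    using d(2) m(2) that by (auto simp: dist_real_def subset_iff)
  have "s \<notin> T" if "s \<in> {t - m<..<t + m}" "s \<noteq> t" for s
    using e(2)[OF I[OF that(1)] _ that(2)] m(3) that(1) by auto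
  with I m(1) show ?thesis by (intro that[of m] subsetI DiffI) auto
qed

lemma constant_across_reflection_times:
  fixes f :: "real \<Rightarrow> 'a::t2_space"
  assumes T: "reflection_times I T"
    and const: "\<And>J. J \<in> components (I - T) \<Longrightarrow> f constant_on J"
    and lim: "\<And>t. t \<in> T \<Longrightarrow> \<exists>l. (f \<longlongrightarrow> l) (at_left t) \<and> (f \<longlongrightarrow> l) (at_right t)"
  shows "f constant_on (I - T)"
proof -
  \<comment> \<open>A connected subset of \<open>I - T\<close> lies in a single component, so
    constancy can be used on small intervals without naming the segment.\<close>
  have sub: "f constant_on C" if C: "connected C" "C \<subseteq> I - T" for C
  proof (cases "I - T = {}")
    case False
    then obtain J where "J \<in> components (I - T)" "C \<subseteq> J"
      using exists_component_superset[OF C(2) _ C(1)] by blast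
    then show ?thesis using const constant_on_subset by blast
  next
    case True
    then have "C = {}" using C(2) by blast
    then show ?thesis by (simp add: constant_on_def)
  qed
  \<comment> \<open>Extending \<open>f\<close> by its limits at the reflection times makes it locally constant on the interval \<open>I\<close>.\<close>
  define g where "g t = (if t \<in> T then Lim (at_left t) f else f t)" for t
  have "\<forall>\<^sub>F s in at t within I. g t = g s" if "t \<in> I" for t
  proof (cases "t \<in> T")
    case False
    obtain e where e: "e > 0" "\<And>s. s \<in> I \<Longrightarrow> s \<in> T \<Longrightarrow> s \<noteq> t \<Longrightarrow> e \<le> \<bar>s - t\<bar>"
      using reflection_times_isolated[OF T \<open>t \<in> I\<close>] by metis
    have "convex (I \<inter> ball t e)"
      using T by (auto simp: reflection_times_def is_interval_convex_1 intro: convex_Int)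
    moreover have notT: "I \<inter> ball t e \<subseteq> I - T"
      using e(2) False by (force simp: dist_real_def abs_minus_commute)
    ultimately have "f constant_on (I \<inter> ball t e)" by (intro sub convex_connected)
    then have "g t = g s" if "s \<in> I" "dist s t < e" for s
      using that \<open>t \<in> I\<close> \<open>e > 0\<close> notT unfolding g_def constant_on_def
      by (smt (verit) DiffD2 IntI centre_in_ball dist_commute mem_ball subsetD)
    then show ?thesis using e(1) unfolding eventually_at by blast
  next
    case True
    obtain e where e: "e > 0" "{t - e<..<t} \<subseteq> I - T" "{t<..<t + e} \<subseteq> I - T"
      using reflection_times_sides[OF T True] by metis
    obtain l where l: "(f \<longlongrightarrow> l) (at_left t)" "(f \<longlongrightarrow> l) (at_right t)"
      using lim[OF True] by blast
    obtain c d where c: "\<And>s. s \<in> {t - e<..<t} \<Longrightarrow> f s = c" and d: "\<And>s. s \<in> {t<..<t + e} \<Longrightarrow> f s = d"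
      using sub[OF connected_Ioo e(2)] sub[OF connected_Ioo e(3)] unfolding constant_on_def by metis
    \<comment> \<open>Each one-sided limit equals the constant on its own side. The limits agree,
      hence so do the constants on the two adjacent segments.\<close>
    have "\<forall>\<^sub>F s in at_left t. f s = c"
      using c e(1) by (intro eventually_at_leftI[of "t - e"]) auto
    then have "c = l"
      using tendsto_unique[OF _ tendsto_eventually l(1)] by simp
    have "\<forall>\<^sub>F s in at_right t. f s = d"
      using d e(1) by (intro eventually_at_rightI[of _ "t + e"]) auto
    then have "d = l"
      using tendsto_unique[OF _ tendsto_eventually l(2)] by simp
    have "g t = g s" if s: "s \<noteq> t" "dist s t < e" for s
    proof -
      have "g t = l" using True tendsto_Lim[OF _ l(1)] by (simp add: g_def)
      moreover have "s \<in> {t - e<..<t} \<or> s \<in> {t<..<t + e}" using s by (auto simp: dist_real_def)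
      then have "g s = l" using c d e(2,3) \<open>c = l\<close> \<open>d = l\<close> unfolding g_def by fastforce
      ultimately show ?thesis by simp
    qed
    then show ?thesis using e(1) unfolding eventually_at by blast
  qed
  moreover have "connected I"
    using T by (simp add: reflection_times_def is_interval_connected_1)
  ultimately have "g s = g t" if "s \<in> I" "t \<in> I" for s t
    using connected_local_const[of I s t g] that by blast
  then show ?thesis
    unfolding constant_on_def g_def by (metis DiffD1 DiffD2)
qed

section \<open>The reflection law for covectors and for planar velocities\<close>

lemma reflects_if_normal:
  assumes "norm v = 1" "norm w = 1" "v \<noteq> w"
    and "\<And>\<tau>. \<tau> \<in> tangent_boundary U x \<Longrightarrow> (v - w) \<bullet> \<tau> = 0"
  shows "reflects U x v w"
proof -
  define n where "n = (1 / norm (v - w)) *\<^sub>R (v - w)"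
  \<comment> \<open>For unit vectors both sides equal 2 - 2 (v, w), with (v, w) the inner product.
    Thus subtracting twice the component of \<open>v\<close> along the normalised difference
    \<open>n\<close> yields \<open>w\<close>.\<close>
  have "(norm (v - w))\<^sup>2 = 2 * (v \<bullet> (v - w))"
    using assms(1,2) by (simp add: power2_norm_eq_inner norm_eq_1 algebra_simps inner_commute)
  then have "(2 * (v \<bullet> n)) *\<^sub>R n = ((norm (v - w))\<^sup>2 / (norm (v - w))\<^sup>2) *\<^sub>R (v - w)"
    by (simp add: n_def power2_eq_square)
  then have "w = v - (2 * (v \<bullet> n)) *\<^sub>R n"
    using assms(3) by simp
  moreover have "norm n = 1" using assms(3) by (simp add: n_def)
  ultimately show ?thesis
    unfolding reflects_def using assms(3,4) by (intro conjI exI[of _ n]) (auto simp: n_def)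
qed

lemma reflection_covectors_cylinder:
  assumes U: "billiard_table U" and q: "q \<in> frontier (cylinder U)"
    and p: "p \<in> unit_covectors q" "p' \<in> unit_covectors q" "p \<noteq> p'"
    and ann: "p - p' \<in> annihilator (tangent_boundary (cylinder U) q)"
  shows "momentum p = momentum p'"
    and "reflects U (lagr_proj q) (planar_velocity q p) (planar_velocity q p')"
proof -
  have zero: "(p - p') \<bullet> v = 0" if "lagr_proj v \<in> tangent_boundary U (lagr_proj q)" for v
    using ann tangent_boundary_cylinder[OF that] unfolding annihilator_def by blast
  \<comment> \<open>The vertical direction is tangent to the boundary of the cylinder, so pairing
    with it compares the two momenta.\<close>
  have "lagr_proj dz = 0"
    by (simp add: lagr_proj_def axis_def vec_eq_iff forall_2)
  then have "(p - p') \<bullet> dz = 0"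
    using zero zero_in_tangent_boundary[OF U frontier_cylinder[OF q]] by simp
  then show m: "momentum p = momentum p'"
    by (simp add: momentum_def inner_axis)
  \<comment> \<open>Both covectors sit over the same point with equal momenta, so the quarter-turn
    terms cancel.\<close>
  have diff: "planar_velocity q p - planar_velocity q p' = lagr_proj (p - p')"
    by (simp add: planar_velocity_eq m linear_diff[OF bounded_linear.linear[OF bounded_linear_lagr_proj]])
  show "reflects U (lagr_proj q) (planar_velocity q p) (planar_velocity q p')"
  proof (rule reflects_if_normal)
    \<comment> \<open>Equal momenta force distinct covectors to differ in their first two entries,
      so the planar reflection is not a grazing contact.\<close>
    show "planar_velocity q p \<noteq> planar_velocity q p'"
      using p(3) m diff by (auto simp: lagr_proj_def momentum_def vec_eq_iff forall_2 forall_3)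
    show "(planar_velocity q p - planar_velocity q p') \<bullet> \<tau> = 0"
      if "\<tau> \<in> tangent_boundary U (lagr_proj q)" for \<tau>
    proof -
      have "lagr_proj (vector [\<tau>$1, \<tau>$2, 0]) = \<tau>"
        by (simp add: lagr_proj_def vec_eq_iff forall_2)
      then have "(p - p') \<bullet> vector [\<tau>$1, \<tau>$2, 0] = 0" using zero that by simp
      then show ?thesis unfolding diff by (simp add: lagr_proj_def inner_vec_def sum_2 sum_3)
    qed
  qed (use p(1,2) in \<open>simp_all add: unit_covectors_iff_norm_planar_velocity[symmetric]\<close>)
qed

section \<open>Projection of a whole billiard trajectory\<close>

theorem proposition5p9:
  fixes U :: "(real^2) set" and I T :: "real set" and \<gamma> p :: "real \<Rightarrow> real^3"
  assumes "billiard_table U"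
    and "billiard_trajectory (cylinder U) I T \<gamma> p"
  shows "\<exists>a. (\<forall>t\<in>I - T. momentum (p t) = a) \<and>
             magnetic_billiard_trajectory U I T a (lagr_proj \<circ> \<gamma>) \<and>
             lift_of I T \<gamma> (lagr_proj \<circ> \<gamma>)"
proof -
  let ?\<eta> = "lagr_proj \<circ> \<gamma>"
  let ?v = "\<lambda>t. planar_velocity (\<gamma> t) (p t)"
  have T: "reflection_times I T" and cont: "continuous_on I \<gamma>" and W: "\<gamma> ` I \<subseteq> cylinder U"
    and geo: "\<And>J. J \<in> components (I - T) \<Longrightarrow> geodesic J \<gamma> p"
    using assms(2) unfolding billiard_trajectory_def by auto
  have cont_eta: "continuous_on I ?\<eta>"
    unfolding o_def by (intro bounded_linear.continuous_on[OF bounded_linear_lagr_proj] cont)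
  \<comment> \<open>The common limit \<open>a\<close> of the momentum may still depend on
    \<open>t\<close> here; it serves to show that the momentum is the same on all segments.\<close>
  have refl: "\<exists>a v_in v_out.
      ((\<lambda>s. momentum (p s)) \<longlongrightarrow> a) (at_left t) \<and> ((\<lambda>s. momentum (p s)) \<longlongrightarrow> a) (at_right t) \<and>
      (?\<eta> has_vector_derivative v_in) (at_left t) \<and> (?\<eta> has_vector_derivative v_out) (at_right t) \<and>
      reflects U (?\<eta> t) v_in v_out" if t: "t \<in> T" for t
  proof -
    obtain p_in p_out where p: "(p \<longlongrightarrow> p_in) (at_left t)" "(p \<longlongrightarrow> p_out) (at_right t)"
      and R: "momentum p_in = momentum p_out"
        "reflects U (lagr_proj (\<gamma> t)) (planar_velocity (\<gamma> t) p_in) (planar_velocity (\<gamma> t) p_out)"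
      using assms(2) t reflection_covectors_cylinder[OF assms(1)]
      unfolding billiard_trajectory_def by (metis (no_types))
    obtain e where e: "e > 0" "{t - e<..<t + e} \<subseteq> I"
        "{t - e<..<t} \<subseteq> I - T" "{t<..<t + e} \<subseteq> I - T"
      using reflection_times_sides[OF T t] by metis
    \<comment> \<open>The geodesic equation gives derivatives only relative to a component. On an
      open connected piece of \<open>I - T\<close> they become two-sided, as the one-sided limit
      lemmas require.\<close>
    have deriv: "(?\<eta> has_vector_derivative ?v s) (at s)"
      if C: "open C" "connected C" "C \<subseteq> I - T" "s \<in> C" for s C
    proof -
      obtain J where J: "J \<in> components (I - T)" "C \<subseteq> J"
        using exists_component_superset[OF C(3) _ C(2)] C(3,4) by blast
      then have "(?\<eta> has_vector_derivative ?v s) (at s within J)"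
        using geodesic_planar_motion(2)[OF geo[OF J(1)], of s] C(4) by (auto simp: o_def)
      then have "(?\<eta> has_vector_derivative ?v s) (at s within C)"
        by (rule has_vector_derivative_within_subset[OF _ J(2)])
      then show ?thesis by (simp only: at_within_open[OF C(4,1)])
    qed
    have "isCont \<gamma> t"
      using continuous_on_subset[OF cont e(2)] e(1) by (simp add: continuous_on_eq_continuous_at)
    then have \<gamma>: "(\<gamma> \<longlongrightarrow> \<gamma> t) (at_left t)" "(\<gamma> \<longlongrightarrow> \<gamma> t) (at_right t)"
      by (auto simp: isCont_def filterlim_at_split)
    \<comment> \<open>The planar velocity is continuous in point and covector jointly, so the
      one-sided limits of \<open>p\<close> yield limits of the velocity, and these are the one-sided
      derivatives of the projection at \<open>t\<close>.\<close>
    have lim: "((\<lambda>s. momentum (p s)) \<longlongrightarrow> momentum p0) F \<and> (?v \<longlongrightarrow> planar_velocity (\<gamma> t) p0) F"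
      if "(p \<longlongrightarrow> p0) F" "(\<gamma> \<longlongrightarrow> \<gamma> t) F" for F p0
      unfolding planar_velocity_eq momentum_def using that
      by (auto intro!: tendsto_intros bounded_linear.tendsto[OF bounded_linear_lagr_proj]
          bounded_linear.tendsto[OF bounded_linear_quarter_turn])
    have "(?\<eta> has_vector_derivative planar_velocity (\<gamma> t) p_in) (at_left t)"
    proof (rule has_vector_derivative_at_left_limit[of "t - e"])
      show "continuous_on {t - e<..t} ?\<eta>"
        using e(1,2) by (intro continuous_on_subset[OF cont_eta]) (force simp: subset_iff)
      show "(?\<eta> has_vector_derivative ?v s) (at s)" if "t - e < s" "s < t" for s
        using that by (intro deriv[OF _ _ e(3)]) auto
    qed (use e(1) lim[OF p(1) \<gamma>(1)] in auto)
    moreover have "(?\<eta> has_vector_derivative planar_velocity (\<gamma> t) p_out) (at_right t)"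
    proof (rule has_vector_derivative_at_right_limit[of _ "t + e"])
      show "continuous_on {t..<t + e} ?\<eta>"
        using e(1,2) by (intro continuous_on_subset[OF cont_eta]) (force simp: subset_iff)
      show "(?\<eta> has_vector_derivative ?v s) (at s)" if "t < s" "s < t + e" for s
        using that by (intro deriv[OF _ _ e(4)]) auto
    qed (use e(1) lim[OF p(2) \<gamma>(2)] in auto)
    ultimately show ?thesis
      using lim[OF p(1) \<gamma>(1)] lim[OF p(2) \<gamma>(2)] R by (auto simp: o_def)
  qed
  have "(\<lambda>t. momentum (p t)) constant_on (I - T)"
  proof (rule constant_across_reflection_times[OF T])
    show "(\<lambda>t. momentum (p t)) constant_on J" if "J \<in> components (I - T)" for J
      using geodesic_momentum_constant[OF geo[OF that] in_components_connected[OF that]] .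
  qed (use refl in blast)
  then obtain a where a: "\<And>t. t \<in> I - T \<Longrightarrow> momentum (p t) = a"
    unfolding constant_on_def by blast
  have "magnetic_billiard_trajectory U I T a ?\<eta>"
    unfolding magnetic_billiard_trajectory_def
  proof (intro conjI ballI)
    show "?\<eta> ` I \<subseteq> U" using W by (auto simp: cylinder_def)
    show "circular_arc a J ?\<eta>" if J: "J \<in> components (I - T)" for J
      using in_components_subset[OF J]
      by (intro geodesic_circular_arc[OF geo[OF J] in_components_connected[OF J]] a) auto
    show "?\<eta> t \<in> frontier U" if "t \<in> T" for t
      using assms(2) that frontier_cylinder unfolding billiard_trajectory_def by auto
    show "\<exists>v_in v_out. (?\<eta> has_vector_derivative v_in) (at_left t) \<and>
        (?\<eta> has_vector_derivative v_out) (at_right t) \<and> reflects U (?\<eta> t) v_in v_out" if "t \<in> T" for t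
      using refl[OF that] by blast
  qed (fact T cont_eta)+
  moreover have "lift_of I T \<gamma> ?\<eta>"
    unfolding lift_of_def
  proof (intro conjI ballI)
    \<comment> \<open>The third entry of the velocity from Hamilton's equations is (x c - y b)/2,
      which is exactly the condition for \<open>alpha_std\<close> to vanish on it.\<close>
    fix J t assume "J \<in> components (I - T)" "t \<in> J"
    then show "\<exists>v\<in>xi_std (\<gamma> t). (\<gamma> has_vector_derivative v) (at t within J)"
      using geodesic_has_vector_derivative(1)[OF geo]
      by (intro bexI) (auto simp: xi_std_def alpha_std_def inner_vec_def sum_3 axis_def field_simps)
  qed (simp_all add: cont)
  ultimately show ?thesis using a by blast
qed

end
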